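(* Let $L_1, L_2$ be two disjoint complete lattices, each with at least two elements, and let $L_1\oplus L_2$ be their ordinal sum. Then there exists a left-continuous t-norm on $L_1\oplus L_2$ if and only if there exists a left-continuous t-norm on $L_2$.
   Context: Ordinal sum: for disjoint lattices $L_1,L_2$, $L_1\oplus L_2$ is the set $L_1\cup L_2$ ordered so that the orders within $L_1$ and within $L_2$ are unchanged and $a<b$ for all $a\in L_1$, $b\in L_2$ (so $1_{L_1}<0_{L_2}$). It is a complete lattice when $L_1,L_2$ are complete. T-norm: a binary operation $T:L^2\to L$ on a bounded lattice $L$ (bottom $0$, top $1$) such that for all $a,b,c\in L$: $T(1,a)=a$; $b\le c$ implies $T(a,b)\le T(a,c)$; $T(a,b)=T(b,a)$; $T(T(a,b),c)=T(a,T(b,c))$. Left-continuity: a t-norm $T$ on a complete lattice $L$ is left-continuous if $T(a,\bigvee S)=\bigvee_{s\in S}T(a,s)$ for all $a\in L$ and all $\emptyset\ne S\subseteq L$. *)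

theory Defs
  imports Main
begin

text \<open>
  Complete lattices are types of class \<open>complete_lattice\<close>. The disjoint union of
  the two lattices is realised by a datatype with one constructor per summand
  (a fresh one, since the ordinal sum order is only one of the possible orders on \<open>'a + 'b\<close>).
\<close>

datatype ('a, 'b) ordinal_sum = Lower 'a | Upper 'b

instantiation ordinal_sum :: (order, order) order
begin

fun less_eq_ordinal_sum :: "('a, 'b) ordinal_sum \<Rightarrow> ('a, 'b) ordinal_sum \<Rightarrow> bool" where
  "Lower a \<le> Lower a' \<longleftrightarrow> a \<le> a'"
| "Lower a \<le> Upper b \<longleftrightarrow> True"
| "Upper b \<le> Lower a \<longleftrightarrow> False"
| "Upper b \<le> Upper b' \<longleftrightarrow> b \<le> b'"

definition less_ordinal_sum :: "('a, 'b) ordinal_sum \<Rightarrow> ('a, 'b) ordinal_sum \<Rightarrow> bool" where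
  "x < y \<longleftrightarrow> x \<le> y \<and> \<not> y \<le> (x :: ('a, 'b) ordinal_sum)"

instance
proof
  fix x y z :: "('a, 'b) ordinal_sum"
  show "x < y \<longleftrightarrow> x \<le> y \<and> \<not> y \<le> x" by (fact less_ordinal_sum_def)
  show "x \<le> x" by (cases x) auto
  show "x \<le> y \<Longrightarrow> y \<le> z \<Longrightarrow> x \<le> z" by (cases x; cases y; cases z) auto
  show "x \<le> y \<Longrightarrow> y \<le> x \<Longrightarrow> x = y" by (cases x; cases y) auto
qed

end

instantiation ordinal_sum :: (complete_lattice, complete_lattice) complete_lattice
begin

definition Sup_ordinal_sum :: "('a, 'b) ordinal_sum set \<Rightarrow> ('a, 'b) ordinal_sum" where
  "Sup S = (if Upper -` S = {} then Lower (Sup (Lower -` S)) else Upper (Sup (Upper -` S)))"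

definition Inf_ordinal_sum :: "('a, 'b) ordinal_sum set \<Rightarrow> ('a, 'b) ordinal_sum" where
  "Inf S = (if Lower -` S = {} then Upper (Inf (Upper -` S)) else Lower (Inf (Lower -` S)))"

definition sup_ordinal_sum ::
    "('a, 'b) ordinal_sum \<Rightarrow> ('a, 'b) ordinal_sum \<Rightarrow> ('a, 'b) ordinal_sum" where
  "sup x y = Sup {x, y :: ('a, 'b) ordinal_sum}"

definition inf_ordinal_sum ::
    "('a, 'b) ordinal_sum \<Rightarrow> ('a, 'b) ordinal_sum \<Rightarrow> ('a, 'b) ordinal_sum" where
  "inf x y = Inf {x, y :: ('a, 'b) ordinal_sum}"

definition bot_ordinal_sum :: "('a, 'b) ordinal_sum" where
  "bot = Lower bot"

definition top_ordinal_sum :: "('a, 'b) ordinal_sum" where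
  "top = Upper top"

instance
proof -
  have Sup_ub: "x \<le> Sup S" if "x \<in> S" for x :: "('a, 'b) ordinal_sum" and S
    using that by (cases x) (auto simp: Sup_ordinal_sum_def intro: Sup_upper)
  have Sup_lub: "Sup S \<le> z" if "\<And>x. x \<in> S \<Longrightarrow> x \<le> z" for z :: "('a, 'b) ordinal_sum" and S
    using that by (cases z) (fastforce simp: Sup_ordinal_sum_def intro: Sup_least)+
  have Inf_lb: "Inf S \<le> x" if "x \<in> S" for x :: "('a, 'b) ordinal_sum" and S
    using that by (cases x) (auto simp: Inf_ordinal_sum_def intro: Inf_lower)
  have Inf_glb: "z \<le> Inf S" if "\<And>x. x \<in> S \<Longrightarrow> z \<le> x" for z :: "('a, 'b) ordinal_sum" and S
    using that by (cases z) (fastforce simp: Inf_ordinal_sum_def intro: Inf_greatest)+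
  show "OFCLASS(('a, 'b) ordinal_sum, complete_lattice_class)"
  proof
    show "Sup {} = (bot :: ('a, 'b) ordinal_sum)"
      by (simp add: Sup_ordinal_sum_def bot_ordinal_sum_def)
    show "Inf {} = (top :: ('a, 'b) ordinal_sum)"
      by (simp add: Inf_ordinal_sum_def top_ordinal_sum_def)
  qed (auto simp: sup_ordinal_sum_def inf_ordinal_sum_def intro: Sup_ub Sup_lub Inf_lb Inf_glb)
qed

end

definition t_norm :: "('a::bounded_lattice \<Rightarrow> 'a \<Rightarrow> 'a) \<Rightarrow> bool" where
  "t_norm T \<longleftrightarrow>
     (\<forall>a. T top a = a) \<and>
     (\<forall>a b c. b \<le> c \<longrightarrow> T a b \<le> T a c) \<and>
     (\<forall>a b. T a b = T b a) \<and>
     (\<forall>a b c. T (T a b) c = T a (T b c))"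

definition left_continuous :: "('a::complete_lattice \<Rightarrow> 'a \<Rightarrow> 'a) \<Rightarrow> bool" where
  "left_continuous T \<longleftrightarrow> (\<forall>a S. S \<noteq> {} \<longrightarrow> T a (Sup S) = (SUP s\<in>S. T a s))"

end

theory Submission
  imports Defs
begin

text \<open>
  A left-continuous t-norm on the upper summand extends to the ordinal sum by letting every
  upper element act as an identity on the lower summand and making all products of two lower
  elements bottom, so the structure of the lower summand is irrelevant. Conversely, restrict a
  t-norm of the sum to the upper summand and collapse all values that fall into the lower
  summand to the bottom of the upper one; the collapsing map preserves suprema and, because
  \<open>T x y \<le> x\<close>, is compatible with iterated products.
\<close>

lemma t_norm_le_left:
  assumes "t_norm T"
  shows "T x y \<le> x"
proof -
  have "T x y \<le> T x top"
    using assms top_greatest unfolding t_norm_def by blast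
  also have "\<dots> = x"
    using assms unfolding t_norm_def by metis
  finally show ?thesis .
qed

fun extend_upper :: "('b \<Rightarrow> 'b \<Rightarrow> 'b) \<Rightarrow>
    ('a::bot, 'b) ordinal_sum \<Rightarrow> ('a, 'b) ordinal_sum \<Rightarrow> ('a, 'b) ordinal_sum" where
  "extend_upper T (Lower a) (Lower a') = Lower bot"
| "extend_upper T (Lower a) (Upper b) = Lower a"
| "extend_upper T (Upper b) (Lower a) = Lower a"
| "extend_upper T (Upper b) (Upper b') = Upper (T b b')"

lemma t_norm_extend_upper:
  fixes T :: "'b::complete_lattice \<Rightarrow> 'b \<Rightarrow> 'b"
  assumes "t_norm T"
  shows "t_norm (extend_upper T :: ('a::complete_lattice, 'b) ordinal_sum \<Rightarrow> _)"
proof -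
  have T: "T top b = b" "b \<le> c \<Longrightarrow> T a b \<le> T a c" "T a b = T b a" "T (T a b) c = T a (T b c)"
    for a b c
    using assms unfolding t_norm_def by blast+
  show ?thesis
    unfolding t_norm_def
  proof (intro conjI allI impI)
    fix x y z :: "('a, 'b) ordinal_sum"
    show "extend_upper T top x = x"
      by (cases x) (simp_all add: top_ordinal_sum_def T(1))
    show "extend_upper T x y \<le> extend_upper T x z" if "y \<le> z"
      using that by (cases x; cases y; cases z) (simp_all add: T(2))
    show "extend_upper T x y = extend_upper T y x"
      by (cases x; cases y) (simp_all add: T(3))
    \<comment> \<open>With exactly one lower factor both sides equal that factor, and with two or
      more both are \<open>Lower bot\<close>; only three upper factors call on associativity of
      \<open>T\<close>.\<close>
    show "extend_upper T (extend_upper T x y) z = extend_upper T x (extend_upper T y z)"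
      by (cases x; cases y; cases z) (simp_all add: T(4))
  qed
qed

text \<open>Multiplication by \<open>Lower a\<close> is a step function, \<open>Lower bot\<close> on
  lower and \<open>Lower a\<close> on upper arguments, and \<open>Sup S\<close> is upper exactly
  when \<open>S\<close> has an upper element. Multiplication by \<open>Upper b\<close> fixes each
  lower element and acts as \<open>T b\<close> on the upper ones.\<close>

lemma left_continuous_extend_upper:
  fixes T :: "'b::complete_lattice \<Rightarrow> 'b \<Rightarrow> 'b"
  assumes "left_continuous T"
  shows "left_continuous (extend_upper T :: ('a::complete_lattice, 'b) ordinal_sum \<Rightarrow> _)"
  unfolding left_continuous_def
proof (intro allI impI)
  fix x :: "('a, 'b) ordinal_sum" and S :: "('a, 'b) ordinal_sum set"
  assume "S \<noteq> {}"
  show "extend_upper T x (Sup S) = (SUP s\<in>S. extend_upper T x s)"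
  proof (cases x)
    case x: (Lower a)
    show ?thesis
    proof (cases "Upper -` S = {}")
      case True
      have "extend_upper T x s = Lower bot" if "s \<in> S" for s
        using that True x by (cases s) auto
      then have "(SUP s\<in>S. extend_upper T x s) = Lower bot"
        using \<open>S \<noteq> {}\<close> by (metis SUP_eq_const)
      then show ?thesis
        using True x by (simp add: Sup_ordinal_sum_def)
    next
      case False
      have "extend_upper T x s \<le> Lower a" for s
        using x by (cases s) simp_all
      moreover obtain b where "Upper b \<in> S"
        using False by blast
      \<comment> \<open>The bound \<open>Lower a\<close> is attained at
        \<open>Upper b\<close>.\<close>
      ultimately have "(SUP s\<in>S. extend_upper T x s) = Lower a"
        using x by (metis SUP_least SUP_upper antisym extend_upper.simps(2))
      then show ?thesis
        using False x by (simp add: Sup_ordinal_sum_def)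
    qed
  next
    case x: (Upper b)
    \<comment> \<open>A supremum in the ordinal sum depends only on the lower and upper parts of the
      set, so it suffices to compute both parts of the image.\<close>
    have lower: "Lower -` extend_upper T x ` S = Lower -` S"
    proof (rule set_eqI)
      show "a \<in> Lower -` extend_upper T x ` S \<longleftrightarrow> a \<in> Lower -` S" for a
      proof
        assume "a \<in> Lower -` extend_upper T x ` S"
        then obtain s where "s \<in> S" "Lower a = extend_upper T x s" by blast
        then show "a \<in> Lower -` S" using x by (cases s) auto
      next
        assume "a \<in> Lower -` S"
        then show "a \<in> Lower -` extend_upper T x ` S"
          using x by (auto intro!: image_eqI[of _ _ "Lower a"])
      qed
    qed
    have upper: "Upper -` extend_upper T x ` S = T b ` (Upper -` S)"
    proof (rule set_eqI)
      show "c \<in> Upper -` extend_upper T x ` S \<longleftrightarrow> c \<in> T b ` (Upper -` S)" for c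
      proof
        assume "c \<in> Upper -` extend_upper T x ` S"
        then obtain s where "s \<in> S" "Upper c = extend_upper T x s" by blast
        then show "c \<in> T b ` (Upper -` S)" using x by (cases s) auto
      next
        assume "c \<in> T b ` (Upper -` S)"
        then obtain d where "Upper d \<in> S" "c = T b d" by blast
        then show "c \<in> Upper -` extend_upper T x ` S"
          using x by (auto intro!: image_eqI[of _ _ "Upper d"])
      qed
    qed
    show ?thesis
      using assms x unfolding Sup_ordinal_sum_def lower upper
      by (simp add: left_continuous_def)
  qed
qed

fun collapse_lower :: "('a, 'b::bot) ordinal_sum \<Rightarrow> 'b" where
  "collapse_lower (Lower a) = bot"
| "collapse_lower (Upper b) = b"

lemma collapse_lower_mono:
  fixes x y :: "('a::order, 'b::bounded_lattice) ordinal_sum"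
  shows "x \<le> y \<Longrightarrow> collapse_lower x \<le> collapse_lower y"
  by (cases x; cases y) simp_all

text \<open>Lower elements collapse to \<open>bot\<close>, which is neutral for suprema; this covers
  the empty set as well.\<close>

lemma collapse_lower_Sup:
  fixes S :: "('a::complete_lattice, 'b::complete_lattice) ordinal_sum set"
  shows "collapse_lower (Sup S) = (SUP s\<in>S. collapse_lower s)"
proof (rule antisym)
  show "(SUP s\<in>S. collapse_lower s) \<le> collapse_lower (Sup S)"
    by (rule SUP_least) (simp add: collapse_lower_mono Sup_upper)
  have "b \<le> (SUP s\<in>S. collapse_lower s)" if "Upper b \<in> S" for b
    using SUP_upper[OF that, of collapse_lower] by simp
  then show "collapse_lower (Sup S) \<le> (SUP s\<in>S. collapse_lower s)"
    by (auto simp: Sup_ordinal_sum_def intro: Sup_least)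
qed

text \<open>Nonemptiness matters: the empty supremum of the sum is \<open>Lower bot\<close>, not
  \<open>Upper bot\<close>.\<close>

lemma Upper_Sup:
  assumes "S \<noteq> {}"
  shows "(Upper (Sup S) :: ('a::complete_lattice, 'b::complete_lattice) ordinal_sum) = Sup (Upper ` S)"
proof -
  have "Upper -` (Upper ` S :: ('a, 'b) ordinal_sum set) = S" by auto
  then show ?thesis using assms by (simp add: Sup_ordinal_sum_def)
qed

definition restrict_upper :: "(('a, 'b::bot) ordinal_sum \<Rightarrow> ('a, 'b) ordinal_sum \<Rightarrow>
    ('a, 'b) ordinal_sum) \<Rightarrow> 'b \<Rightarrow> 'b \<Rightarrow> 'b" where
  "restrict_upper T b c = collapse_lower (T (Upper b) (Upper c))"

text \<open>Collapsing an intermediate product loses nothing, which is the key to associativity: for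
  lower \<open>x\<close> both sides are \<open>bot\<close>, since a product never exceeds its first
  factor.\<close>

lemma restrict_upper_collapse_lower:
  fixes T :: "('a::complete_lattice, 'b::complete_lattice) ordinal_sum \<Rightarrow> _"
  assumes "t_norm T"
  shows "restrict_upper T (collapse_lower x) c = collapse_lower (T x (Upper c))"
proof (cases x)
  case (Lower a)
  have "collapse_lower (T y z) \<le> collapse_lower y" for y z
    using assms by (simp add: t_norm_le_left collapse_lower_mono)
  \<comment> \<open>The first instance bounds the right-hand side by \<open>bot\<close>, the second
    the left-hand side, where \<open>x\<close> has been replaced by
    \<open>Upper bot\<close>.\<close>
  from this[of x "Upper c"] this[of "Upper bot" "Upper c"] show ?thesis
    using Lower by (simp add: restrict_upper_def bot_unique)
qed (simp add: restrict_upper_def)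

lemma t_norm_restrict_upper:
  fixes T :: "('a::complete_lattice, 'b::complete_lattice) ordinal_sum \<Rightarrow> _"
  assumes "t_norm T"
  shows "t_norm (restrict_upper T)"
proof -
  have T: "T top x = x" "y \<le> z \<Longrightarrow> T x y \<le> T x z" "T x y = T y x" "T (T x y) z = T x (T y z)"
    for x y z
    using assms unfolding t_norm_def by blast+
  have comm: "restrict_upper T b c = restrict_upper T c b" for b c
    unfolding restrict_upper_def using T(3) by metis
  show ?thesis
    unfolding t_norm_def
  proof (intro conjI allI impI)
    fix a b c :: 'b
    show "restrict_upper T top a = a"
      using T(1) by (simp add: restrict_upper_def top_ordinal_sum_def)
    show "restrict_upper T a b \<le> restrict_upper T a c" if "b \<le> c"
      unfolding restrict_upper_def using that by (simp add: T(2) collapse_lower_mono)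
    show "restrict_upper T a b = restrict_upper T b a"
      by (rule comm)
    have left: "restrict_upper T (restrict_upper T a b) c =
        collapse_lower (T (T (Upper a) (Upper b)) (Upper c))" for a b c
      using restrict_upper_collapse_lower[OF assms] unfolding restrict_upper_def[of T a b] .
    \<comment> \<open>\<open>left\<close> handles a collapsed product in the first argument only, so
      commutativity moves it there.\<close>
    have "restrict_upper T a (restrict_upper T b c) =
        collapse_lower (T (T (Upper b) (Upper c)) (Upper a))"
      using left comm by metis
    then show "restrict_upper T (restrict_upper T a b) c = restrict_upper T a (restrict_upper T b c)"
      using left T(3,4) by metis
  qed
qed

lemma left_continuous_restrict_upper:
  fixes T :: "('a::complete_lattice, 'b::complete_lattice) ordinal_sum \<Rightarrow> _"
  assumes "left_continuous T"
  shows "left_continuous (restrict_upper T)"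
  unfolding left_continuous_def
proof (intro allI impI)
  fix b :: 'b and S :: "'b set"
  assume "S \<noteq> {}"
  \<comment> \<open>\<open>Upper_Sup\<close> turns the supremum in the summand into one in the
    ordinal sum, where left-continuity of \<open>T\<close> applies.\<close>
  then have "T (Upper b) (Upper (Sup S)) = (SUP s\<in>S. T (Upper b) (Upper s))"
    using assms by (simp add: Upper_Sup left_continuous_def image_image)
  then show "restrict_upper T b (Sup S) = (SUP s\<in>S. restrict_upper T b s)"
    by (simp add: restrict_upper_def collapse_lower_Sup image_image)
qed

theorem theorem3p1:
  assumes "\<exists>x y :: 'a::complete_lattice. x \<noteq> y"
    and "\<exists>x y :: 'b::complete_lattice. x \<noteq> y"
  shows "(\<exists>T :: ('a, 'b) ordinal_sum \<Rightarrow> ('a, 'b) ordinal_sum \<Rightarrow> ('a, 'b) ordinal_sum.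
            t_norm T \<and> left_continuous T) \<longleftrightarrow>
         (\<exists>T :: 'b \<Rightarrow> 'b \<Rightarrow> 'b. t_norm T \<and> left_continuous T)"
  by (metis t_norm_restrict_upper left_continuous_restrict_upper
      t_norm_extend_upper left_continuous_extend_upper)

end
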